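(* For all integers $n\ge 1$ and $0\le k\le n$, $$i_B(n,k)=\binom{n+k-1}{k}+\sum_{j=1}^{+\infty}(-1)^j\binom{n+k-2u_j-2j-1}{k-2u_j-2j}+\sum_{j=1}^{+\infty}(-1)^j\binom{n+k-2u_j-1}{k-2u_j},$$ where $u_j=\frac{j(3j-1)}{2}$.
   Context: $B_n$ is the hyperoctahedral group: the group of bijections $\pi$ of $\{-n,\ldots,-1,1,\ldots,n\}$ with $\pi(-j)=-\pi(j)$ for all $j\in\{1,\dots,n\}$. Every $\pi\in B_n$ is written uniquely as $\pi(p)=(-1)^{r_p}\sigma_p$ for $1\le p\le n$, with $r_p\in\{0,1\}$ and $\sigma=\sigma_1\cdots\sigma_n$ a permutation of $\{1,\dots,n\}$. For $1\le i\le n$ put $m=n+1-i$ and $inv_i(\sigma)=|\{j: j<m,\ \sigma_j>\sigma_m\}|$, and define $inv_i(\pi)=inv_i(\sigma)$ if $r_m=0$, and $inv_i(\pi)=1+2|\{j: j<m,\ \sigma_j<\sigma_m\}|+inv_i(\sigma)$ if $r_m=1$. The number of inversions of type $B$ of $\pi$ is $inv_B(\pi)=\sum_{i=1}^n inv_i(\pi)$. The Mahonian number of type $B$ is $i_B(n,k)=|\{\pi\in B_n: inv_B(\pi)=k\}|$. Binomial coefficients with negative lower index are $0$ (so the sums are finite). *)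

theory Defs
  imports "HOL-Analysis.Infinite_Sum" "HOL-Combinatorics.Permutations"
begin

(* The constant permutes also forces \<pi> to be the identity outside the given set, so that each
   bijection of {-n,...,-1,1,...,n} is represented by exactly one function on int. *)
definition hyperoctahedral :: "nat \<Rightarrow> (int \<Rightarrow> int) set" where
  "hyperoctahedral n =
     {\<pi>. \<pi> permutes ({- int n..int n} - {0}) \<and> (\<forall>j\<in>{1..int n}. \<pi> (- j) = - \<pi> j)}"

(* The pair (r, \<sigma>) in the decomposition \<pi>(p) = (-1)^(r_p) \<sigma>_p, for 1 \<le> p \<le> n. *)
definition sign_part :: "(int \<Rightarrow> int) \<Rightarrow> nat \<Rightarrow> nat" where
  "sign_part \<pi> p = (if \<pi> (int p) < 0 then 1 else 0)"

definition abs_part :: "(int \<Rightarrow> int) \<Rightarrow> nat \<Rightarrow> nat" where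
  "abs_part \<pi> p = nat \<bar>\<pi> (int p)\<bar>"

definition inv_perm :: "nat \<Rightarrow> nat \<Rightarrow> (nat \<Rightarrow> nat) \<Rightarrow> nat" where
  "inv_perm n i \<sigma> = (let m = n + 1 - i in card {j. 1 \<le> j \<and> j < m \<and> \<sigma> j > \<sigma> m})"

definition inv_signed :: "nat \<Rightarrow> nat \<Rightarrow> (int \<Rightarrow> int) \<Rightarrow> nat" where
  "inv_signed n i \<pi> =
     (let m = n + 1 - i; \<sigma> = abs_part \<pi> in
      if sign_part \<pi> m = 0 then inv_perm n i \<sigma>
      else 1 + 2 * card {j. 1 \<le> j \<and> j < m \<and> \<sigma> j < \<sigma> m} + inv_perm n i \<sigma>)"

definition inv_B :: "nat \<Rightarrow> (int \<Rightarrow> int) \<Rightarrow> nat" where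
  "inv_B n \<pi> = (\<Sum>i=1..n. inv_signed n i \<pi>)"

definition mahonian_B :: "nat \<Rightarrow> nat \<Rightarrow> nat" where
  "mahonian_B n k = card {\<pi> \<in> hyperoctahedral n. inv_B n \<pi> = k}"

(* The division is exact. *)
definition pentagonal :: "nat \<Rightarrow> int" where
  "pentagonal j = int j * (3 * int j - 1) div 2"

definition int_binomial :: "int \<Rightarrow> int \<Rightarrow> real" where
  "int_binomial a b = (if b < 0 then 0 else real_of_int a gchoose nat b)"

end

theory Submission
  imports Defs "HOL-Computational_Algebra.Formal_Power_Series"
begin

text \<open>
  Reading a signed permutation from right to left, the number \<open>inv_i\<close> at position \<open>m\<close> depends only
  on the sign of the entry there and on its rank among the absolute values of the first \<open>m\<close>
  entries. An entry exceeding exactly \<open>r\<close> of the \<open>m - 1\<close> earlier absolute values contributes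
  \<open>m - 1 - r\<close> if it is positive and \<open>m + r\<close> if it is negative, so the \<open>2 m\<close> choices produce each of
  \<open>0, \<dots>, 2 m - 1\<close> exactly once. Hence the generating function of \<open>inv_B\<close> is the product over
  \<open>m \<le> n\<close> of \<open>1 + X + \<dots> + X^(2 m - 1)\<close> (lemmas \<open>sum_word_inv\<close> and \<open>mahonian_B_eq_coeff\<close>), that is,
  the product of the \<open>1 - X^(2 m)\<close> divided by \<open>(1 - X)^n\<close>.

  Put \<open>q = X^2\<close>. Euler's pentagonal number theorem expands the infinite product of the
  \<open>1 - q^m\<close> as the sum of \<open>(-1)^j (q^(j (3 j - 1) / 2) + q^(j (3 j + 1) / 2))\<close> over \<open>j \<ge> 1\<close>, plus \<open>1\<close>.
  Since \<open>k \<le> n\<close>, only the product of the first \<open>n\<close> factors modulo \<open>q^(n + 1)\<close> matters, and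
  \<open>euler_product_mod\<close> obtains that from a finite identity of Shanks that is proved by telescoping,
  without any convergence argument. Multiplying by \<open>1 / (1 - X)^n\<close>, whose
  coefficients are the binomials \<open>n + i - 1\<close> over \<open>i\<close>, and reading off the coefficient of
  \<open>X^k\<close> gives the formula: the exponents \<open>2 u_j\<close> and \<open>2 u_j + 2 j\<close> give the two sums.
\<close>

section \<open>The generating function of signed words\<close>

text \<open>
  Signed permutations are handled as lists with the last entry first, so that the head of a list is
  an entry compared with all the others. Allowing any set \<open>A\<close> of absolute values
  keeps the notion stable under removal of the head.
\<close>

definition signed_words :: "int set \<Rightarrow> int list set" where
  "signed_words A = {w. distinct (map abs w) \<and> abs ` set w = A}"

definition head_inv :: "int \<Rightarrow> int list \<Rightarrow> nat" where
  "head_inv x w = (if x < 0 then 1 + 2 * length (filter (\<lambda>y. \<bar>y\<bar> < \<bar>x\<bar>) w) else 0)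
     + length (filter (\<lambda>y. \<bar>y\<bar> > \<bar>x\<bar>) w)"

fun word_inv :: "int list \<Rightarrow> nat" where
  "word_inv [] = 0"
| "word_inv (x # w) = head_inv x w + word_inv w"

lemma length_signed_word:
  assumes "w \<in> signed_words A"
  shows "length w = card A"
  using assms distinct_card[of "map abs w"] by (auto simp: signed_words_def)

lemma set_signed_word:
  assumes "w \<in> signed_words A"
  shows "set w \<subseteq> A \<union> uminus ` A"
proof
  fix x assume "x \<in> set w"
  then have "\<bar>x\<bar> \<in> A" using assms by (auto simp: signed_words_def)
  then show "x \<in> A \<union> uminus ` A"
    by (cases "x < 0") (auto simp: image_iff intro: bexI[of _ "-x"])
qed

lemma finite_signed_words:
  assumes "finite A"
  shows "finite (signed_words A)"
proof (rule finite_subset)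
  show "signed_words A \<subseteq> {w. set w \<subseteq> A \<union> uminus ` A \<and> length w = card A}"
    using length_signed_word set_signed_word by blast
  show "finite {w. set w \<subseteq> A \<union> uminus ` A \<and> length w = card A}"
    using assms by (intro finite_lists_length_eq) auto
qed

text \<open>
  Counts of entries by absolute value depend only on the set of absolute values; this decouples
  the inversions at the head from the order and the signs in the tail.
\<close>

lemma length_filter_signed_word:
  assumes "w \<in> signed_words A"
  shows "length (filter (\<lambda>y. P \<bar>y\<bar>) w) = card {a \<in> A. P a}"
proof -
  have d: "distinct (map abs w)" and s: "abs ` set w = A"
    using assms by (auto simp: signed_words_def)
  have "length (filter (\<lambda>y. P \<bar>y\<bar>) w) = length (filter P (map abs w))"
    by (simp add: filter_map o_def)
  also have "\<dots> = card (set (filter P (map abs w)))"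
    using d by (intro distinct_card[symmetric] distinct_filter)
  also have "set (filter P (map abs w)) = {a \<in> A. P a}"
    using s by auto
  finally show ?thesis .
qed

text \<open>Ranks strictly increase along \<open>A\<close> and stay below its size, so they take every value once.\<close>

lemma bij_betw_rank:
  fixes A :: "'a :: linorder set"
  assumes "finite A"
  shows "bij_betw (\<lambda>x. card {y \<in> A. y < x}) A {..<card A}"
proof -
  have less: "card {y \<in> A. y < x} < card {y \<in> A. y < z}" if "x \<in> A" "x < z" for x z
  proof (rule psubset_card_mono)
    have "{y \<in> A. y < x} \<subseteq> {y \<in> A. y < z}" using that(2) by (auto intro: less_trans)
    then show "{y \<in> A. y < x} \<subset> {y \<in> A. y < z}" using that by blast
  qed (use assms in simp)
  have inj: "inj_on (\<lambda>x. card {y \<in> A. y < x}) A"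
  proof (rule inj_onI)
    fix x z assume "x \<in> A" "z \<in> A" "card {y \<in> A. y < x} = card {y \<in> A. y < z}"
    with less[of x z] less[of z x] show "x = z" by (cases x z rule: linorder_cases) auto
  qed
  have "card {y \<in> A. y < x} < card A" if "x \<in> A" for x
    using assms that by (intro psubset_card_mono) blast+
  then have sub: "(\<lambda>x. card {y \<in> A. y < x}) ` A \<subseteq> {..<card A}"
    by auto
  have "(\<lambda>x. card {y \<in> A. y < x}) ` A = {..<card A}"
    using card_image[OF inj] by (intro card_subset_eq sub) auto
  with inj show ?thesis by (simp add: bij_betw_def)
qed

text \<open>
  The possible heads of a word over \<open>A\<close> realise each inversion count below \<open>2 * card A\<close> once: the
  positive ones give the lower half in decreasing order of rank, the negative ones the upper half
  in increasing order. The tail \<open>W x\<close> behind the head is arbitrary, since only the set of its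
  absolute values enters.
\<close>

lemma sum_head_inv:
  fixes q :: "'a :: comm_ring_1"
  assumes "finite A" "A \<subseteq> {0<..}" 
    and W: "\<And>x. x \<in> A \<union> uminus ` A \<Longrightarrow> W x \<in> signed_words (A - {\<bar>x\<bar>})"
  shows "(\<Sum>x\<in>A \<union> uminus ` A. q ^ head_inv x (W x)) = (\<Sum>i<2 * card A. q ^ i)"
proof -
  define n where "n = card A"
  define r where "r x = card {y \<in> A. y < x}" for x
  have rank: "bij_betw r A {..<n}"
    unfolding r_def n_def by (rule bij_betw_rank) fact
  have greater: "card {y \<in> A. x < y} = n - Suc (r x)" if "x \<in> A" for x
  proof -
    have "A = insert x ({y \<in> A. y < x} \<union> {y \<in> A. x < y})" using that by auto
    then have "n = card (insert x ({y \<in> A. y < x} \<union> {y \<in> A. x < y}))"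
      unfolding n_def by simp
    also have "\<dots> = Suc (r x + card {y \<in> A. x < y})"
      using assms(1) unfolding r_def
      by (subst card_insert_disjoint) (auto simp: card_Un_disjoint disjoint_iff)
    finally show ?thesis by simp
  qed
  have pos: "head_inv x (W x) = n - Suc (r x)" if "x \<in> A" for x
  proof -
    have "x > 0" using that assms(2) by auto
    moreover have "W x \<in> signed_words (A - {x})" using W[of x] \<open>x > 0\<close> that by auto
    moreover have "{a \<in> A - {x}. x < a} = {y \<in> A. x < y}" by auto
    ultimately show ?thesis using greater[OF that] length_filter_signed_word[of "W x" "A - {x}" "\<lambda>a. x < a"]
      by (simp add: head_inv_def)
  qed
  have neg: "head_inv (- x) (W (- x)) = n + r x" if "x \<in> A" for x
  proof -
    have "x > 0" using that assms(2) by auto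
    moreover have "W (- x) \<in> signed_words (A - {x})" using W[of "- x"] \<open>x > 0\<close> that by auto
    moreover have "{a \<in> A - {x}. x < a} = {y \<in> A. x < y}" "{a \<in> A - {x}. a < x} = {y \<in> A. y < x}" 
      by auto
    moreover have "r x < n" using rank that by (auto simp: bij_betw_def)
    ultimately show ?thesis using greater[OF that] length_filter_signed_word[of "W (- x)" "A - {x}" "\<lambda>a. x < a"]
        length_filter_signed_word[of "W (- x)" "A - {x}" "\<lambda>a. a < x"]
      by (simp add: head_inv_def r_def)
  qed
  have "(\<Sum>x\<in>A \<union> uminus ` A. q ^ head_inv x (W x))
      = (\<Sum>x\<in>A. q ^ head_inv x (W x)) + (\<Sum>x\<in>uminus ` A. q ^ head_inv x (W x))"
  proof (rule sum.union_disjoint)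
    have "- x \<notin> A" if "x \<in> A" for x
      using that assms(2) by (metis greaterThan_iff less_asym neg_0_less_iff_less subsetD)
    then show "A \<inter> uminus ` A = {}" by auto
  qed (use assms(1) in auto)
  also have "(\<Sum>x\<in>uminus ` A. q ^ head_inv x (W x)) = (\<Sum>x\<in>A. q ^ (n + r x))"
    by (subst sum.reindex) (auto simp: neg)
  also have "\<dots> = (\<Sum>i<n. q ^ (n + i))"
    by (rule sum.reindex_bij_betw[OF rank])
  also have "(\<Sum>x\<in>A. q ^ head_inv x (W x)) = (\<Sum>x\<in>A. q ^ (n - Suc (r x)))"
    by (simp add: pos)
  also have "\<dots> = (\<Sum>i<n. q ^ (n - Suc i))"
    by (rule sum.reindex_bij_betw[OF rank])
  also have "\<dots> = (\<Sum>i<n. q ^ i)"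
    by (rule sum.nat_diff_reindex)
  also have "\<dots> + (\<Sum>i<n. q ^ (n + i)) = (\<Sum>i<2 * n. q ^ i)"
    using sum.nat_group[of "\<lambda>i. q ^ i" n 2] by (simp add: numeral_2_eq_2 lessThan_atLeast0 sum.atLeast_Suc_lessThan
         sum.shift_bounds_nat_ivl[of _ 0 n n, symmetric] add.commute sum.atLeastLessThan_concat)
  finally show ?thesis by (simp add: n_def)
qed

lemma signed_words_insert:
  assumes "A \<subseteq> {0<..}" "A \<noteq> {}"
  shows "bij_betw (\<lambda>(x, w). x # w) (SIGMA x:A \<union> uminus ` A. signed_words (A - {\<bar>x\<bar>}))
           (signed_words A)"
proof (rule bij_betw_imageI)
  show "inj_on (\<lambda>(x, w). x # w) (SIGMA x:A \<union> uminus ` A. signed_words (A - {\<bar>x\<bar>}))"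
    by (auto simp: inj_on_def)
  show "(\<lambda>(x, w). x # w) ` (SIGMA x:A \<union> uminus ` A. signed_words (A - {\<bar>x\<bar>})) = signed_words A"
  proof (intro set_eqI iffI)
    fix v assume "v \<in> (\<lambda>(x, w). x # w) ` (SIGMA x:A \<union> uminus ` A. signed_words (A - {\<bar>x\<bar>}))"
    then obtain x w where "v = x # w" "x \<in> A \<union> uminus ` A" "w \<in> signed_words (A - {\<bar>x\<bar>})"
      by auto
    moreover from this have "\<bar>x\<bar> \<in> A" using assms(1) by fastforce
    ultimately show "v \<in> signed_words A"
      by (auto simp: signed_words_def)
  next
    fix v assume v: "v \<in> signed_words A"
    then obtain x w where xw: "v = x # w"
      using assms(2) by (cases v) (auto simp: signed_words_def)
    have "x \<in> A \<union> uminus ` A" using set_signed_word[OF v] xw by simp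
    moreover have "w \<in> signed_words (A - {\<bar>x\<bar>})"
      using v xw unfolding signed_words_def by (auto simp: image_iff)
    ultimately show "v \<in> (\<lambda>(x, w). x # w) ` (SIGMA x:A \<union> uminus ` A. signed_words (A - {\<bar>x\<bar>}))"
      using xw by force
  qed
qed

lemma head_inv_signed_words_cong:
  assumes "v \<in> signed_words A" "w \<in> signed_words A"
  shows "head_inv x v = head_inv x w"
proof -
  have "length (filter (\<lambda>y. P \<bar>y\<bar>) v) = length (filter (\<lambda>y. P \<bar>y\<bar>) w)" for P
    using assms by (simp only: length_filter_signed_word)
  from this[of "\<lambda>a. a < \<bar>x\<bar>"] this[of "\<lambda>a. \<bar>x\<bar> < a"] show ?thesis
    by (simp only: head_inv_def)
qed

text \<open>
  Splitting off the head leaves a sum over tails whose value, by induction, is the same for every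
  head, because it depends only on the size of the remaining set. The sum therefore factors.
\<close>

lemma sum_word_inv:
  fixes q :: "'a :: comm_ring_1"
  assumes "finite A" "A \<subseteq> {0<..}"
  shows "(\<Sum>w\<in>signed_words A. q ^ word_inv w) = (\<Prod>m=1..card A. \<Sum>i<2 * m. q ^ i)"
  using assms
proof (induction "card A" arbitrary: A)
  case 0
  then have "signed_words A = {[]}" by (auto simp: signed_words_def)
  then show ?case using 0 by simp
next
  case (Suc n)
  let ?H = "A \<union> uminus ` A" and ?S = "\<lambda>x. signed_words (A - {\<bar>x\<bar>})"
  let ?P = "\<Prod>m=1..n. \<Sum>i<2 * m. q ^ i"
  have IH: "(\<Sum>w\<in>?S x. q ^ word_inv w) = ?P" if "x \<in> ?H" for x
  proof -
    have "\<bar>x\<bar> \<in> A" using that Suc.prems(2) by fastforce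
    then have "n = card (A - {\<bar>x\<bar>})" using Suc.hyps(2) Suc.prems(1) by simp
    with Suc.hyps(1)[of "A - {\<bar>x\<bar>}"] Suc.prems show ?thesis by auto
  qed
  \<comment> \<open>Some tail for each head, as a representative: the count at the head is the same for all tails.\<close>
  define W where "W x = sorted_list_of_set (A - {\<bar>x\<bar>})" for x
  have W: "W x \<in> ?S x" for x
  proof -
    have "map abs (W x) = W x"
      using Suc.prems by (intro map_idI) (auto simp: W_def)
    moreover have "set (W x) = A - {\<bar>x\<bar>}" "distinct (W x)"
      using Suc.prems by (auto simp: W_def)
    ultimately show ?thesis
      unfolding signed_words_def by (metis (mono_tags, lifting) list.set_map mem_Collect_eq)
  qed
  have "A \<noteq> {}" using Suc.hyps(2) by auto
  have "(\<Sum>w\<in>signed_words A. q ^ word_inv w)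
      = (\<Sum>(x, w)\<in>(SIGMA x:?H. ?S x). q ^ word_inv (x # w))"
    using sum.reindex_bij_betw[OF signed_words_insert[OF Suc.prems(2) \<open>A \<noteq> {}\<close>], of "\<lambda>w. q ^ word_inv w"]
    by (simp add: case_prod_unfold)
  also have "\<dots> = (\<Sum>x\<in>?H. \<Sum>w\<in>?S x. q ^ word_inv (x # w))"
    using Suc.prems(1) by (intro sum.Sigma[symmetric] ballI finite_signed_words) auto
  also have "\<dots> = (\<Sum>x\<in>?H. q ^ head_inv x (W x) * ?P)"
  proof (rule sum.cong[OF refl])
    fix x assume x: "x \<in> ?H"
    have "(\<Sum>w\<in>?S x. q ^ word_inv (x # w)) = (\<Sum>w\<in>?S x. q ^ head_inv x (W x) * q ^ word_inv w)"
      by (intro sum.cong refl) (simp add: power_add head_inv_signed_words_cong[OF _ W])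
    then show "(\<Sum>w\<in>?S x. q ^ word_inv (x # w)) = q ^ head_inv x (W x) * ?P"
      by (simp add: sum_distrib_left[symmetric] IH[OF x])
  qed
  also have "\<dots> = (\<Sum>i<2 * card A. q ^ i) * ?P"
    by (simp add: sum_distrib_right[symmetric] sum_head_inv[OF Suc.prems W])
  finally show ?case using Suc.hyps(2)[symmetric] by (simp add: mult.commute)
qed

section \<open>Signed permutations as signed words\<close>

text \<open>The one-line notation of \<open>\<pi>\<close> in reverse order, \<open>\<pi> n, \<dots>, \<pi> 1\<close>.\<close>

definition window :: "nat \<Rightarrow> (int \<Rightarrow> int) \<Rightarrow> int list" where
  "window n \<pi> = map (\<lambda>p. \<pi> (int p)) (rev [1..<Suc n])"

lemma length_filter_window:
  "length (filter P (window n \<pi>)) = card {j. 1 \<le> j \<and> j < Suc n \<and> P (\<pi> (int j))}"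
proof -
  have "length (filter P (window n \<pi>)) = length (filter (\<lambda>j. P (\<pi> (int j))) (rev [1..<Suc n]))"
    by (simp add: window_def filter_map o_def del: upt_Suc)
  also have "\<dots> = card (set (filter (\<lambda>j. P (\<pi> (int j))) (rev [1..<Suc n])))"
    by (intro distinct_card[symmetric] distinct_filter) simp
  also have "set (filter (\<lambda>j. P (\<pi> (int j))) (rev [1..<Suc n])) = {j. 1 \<le> j \<and> j < Suc n \<and> P (\<pi> (int j))}"
    by auto
  finally show ?thesis .
qed

lemma inv_B_eq_word_inv: "inv_B n \<pi> = word_inv (window n \<pi>)"
proof -
  have eq: "inv_signed n i \<pi> = head_inv (\<pi> (int m)) (window (m - 1) \<pi>)"
    if "1 \<le> m" "m \<le> n" "i = n + 1 - m" for i m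
  proof -
    have *: "n + 1 - i = m" "Suc (m - 1) = m" using that by auto
    have nat_abs: "nat \<bar>a\<bar> < nat \<bar>b\<bar> \<longleftrightarrow> \<bar>a\<bar> < \<bar>b\<bar>" for a b :: int by auto
    show ?thesis
      unfolding inv_signed_def inv_perm_def head_inv_def length_filter_window sign_part_def
        abs_part_def Let_def nat_abs * by simp
  qed
  have "inv_B n \<pi> = (\<Sum>m=1..n. inv_signed n (n + 1 - m) \<pi>)"
    unfolding inv_B_def by (rule sum.reindex_bij_witness[of _ "\<lambda>m. n + 1 - m" "\<lambda>m. n + 1 - m"]) auto
  also have "\<dots> = (\<Sum>m=1..n. head_inv (\<pi> (int m)) (window (m - 1) \<pi>))"
    by (intro sum.cong refl eq) auto
  also have "\<dots> = word_inv (window n \<pi>)"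
    by (induction n) (simp_all add: window_def)
  finally show ?thesis .
qed

text \<open>Oddness extends to all integers, because \<open>\<pi>\<close> is the identity outside its domain.\<close>

lemma hyperoctahedral_minus:
  assumes "\<pi> \<in> hyperoctahedral n"
  shows "\<pi> (- x) = - \<pi> x"
proof -
  have p: "\<pi> permutes ({- int n..int n} - {0})" and o: "\<And>j. j \<in> {1..int n} \<Longrightarrow> \<pi> (- j) = - \<pi> j"
    using assms by (auto simp: hyperoctahedral_def)
  consider "x \<in> {1..int n}" | "- x \<in> {1..int n}" | "x \<notin> {- int n..int n} - {0}" "- x \<notin> {- int n..int n} - {0}"
    by fastforce
  then show ?thesis
  proof cases
    case 2
    with o[of "- x"] show ?thesis by simp
  next
    case 3
    then show ?thesis using permutes_not_in[OF p, of x] permutes_not_in[OF p, of "- x"] by simp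
  qed (use o in auto)
qed

lemma window_hyperoctahedral:
  assumes "\<pi> \<in> hyperoctahedral n"
  shows "window n \<pi> \<in> signed_words {1..int n}"
proof -
  let ?D = "{- int n..int n} - {0}"
  have p: "\<pi> permutes ?D" using assms by (auto simp: hyperoctahedral_def)
  have inj: "inj_on (\<lambda>j. \<bar>\<pi> (int j)\<bar>) (set (rev [1..<Suc n]))"
  proof (rule inj_onI)
    fix i j assume ij: "i \<in> set (rev [1..<Suc n])" "j \<in> set (rev [1..<Suc n])" "\<bar>\<pi> (int i)\<bar> = \<bar>\<pi> (int j)\<bar>"
    then have "\<pi> (int i) = \<pi> (int j) \<or> \<pi> (int i) = \<pi> (- int j)"
      using hyperoctahedral_minus[OF assms, of "int j"] by linarith
    then have "int i = int j \<or> int i = - int j"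
      using permutes_inj[OF p] unfolding inj_def by blast
    then show "i = j" by linarith
  qed
  have sub: "(\<lambda>j. \<bar>\<pi> (int j)\<bar>) ` {1..n} \<subseteq> {1..int n}"
  proof
    fix y assume "y \<in> (\<lambda>j. \<bar>\<pi> (int j)\<bar>) ` {1..n}"
    then obtain j where j: "j \<in> {1..n}" "y = \<bar>\<pi> (int j)\<bar>" by auto
    then have "\<pi> (int j) \<in> ?D" using permutes_in_image[OF p, of "int j"] by auto
    with j show "y \<in> {1..int n}" by auto
  qed
  have "set (rev [1..<Suc n]) = {1..n}" by auto
  with inj have "card ((\<lambda>j. \<bar>\<pi> (int j)\<bar>) ` {1..n}) = card {1..int n}"
    by (simp add: card_image del: upt_Suc)
  then have "(\<lambda>j. \<bar>\<pi> (int j)\<bar>) ` {1..n} = {1..int n}"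
    by (intro card_subset_eq sub) auto
  moreover have m: "map abs (window n \<pi>) = map (\<lambda>j. \<bar>\<pi> (int j)\<bar>) (rev [1..<Suc n])"
    by (simp add: window_def del: upt_Suc)
  then have "distinct (map abs (window n \<pi>))"
    using inj by (simp add: distinct_map del: upt_Suc)
  moreover have "abs ` set (window n \<pi>) = (\<lambda>j. \<bar>\<pi> (int j)\<bar>) ` {1..n}"
    using arg_cong[OF m, of set] by (simp add: atLeastLessThanSuc_atLeastAtMost del: upt_Suc)
  ultimately show ?thesis by (simp add: signed_words_def)
qed

lemma inj_on_window: "inj_on (window n) (hyperoctahedral n)"
proof (rule inj_onI)
  fix \<pi> \<rho> assume \<pi>: "\<pi> \<in> hyperoctahedral n" and \<rho>: "\<rho> \<in> hyperoctahedral n"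
    and eq: "window n \<pi> = window n \<rho>"
  have pos: "\<pi> x = \<rho> x" if "x \<in> {1..int n}" for x
  proof -
    have "nat x \<in> set (rev [1..<Suc n])" using that by auto
    with eq have "\<pi> (int (nat x)) = \<rho> (int (nat x))" unfolding window_def map_eq_conv by blast
    with that show ?thesis by simp
  qed
  show "\<pi> = \<rho>"
  proof
    fix x
    consider "x \<in> {1..int n}" | "- x \<in> {1..int n}" | "x \<notin> {- int n..int n} - {0}" by fastforce
    then show "\<pi> x = \<rho> x"
    proof cases
      case 2
      with pos[of "- x"] show ?thesis
        by (simp add: hyperoctahedral_minus[OF \<pi>] hyperoctahedral_minus[OF \<rho>])
    next
      case 3
      with \<pi> \<rho> show ?thesis by (simp add: hyperoctahedral_def permutes_def)
    qed (use pos in auto)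
  qed
qed

text \<open>The entries of the word prescribe \<open>\<pi>\<close> on positive arguments; oddness forces the rest.\<close>

lemma signed_word_is_window:
  assumes w: "w \<in> signed_words {1..int n}"
  shows "w \<in> window n ` hyperoctahedral n"
proof -
  let ?D = "{- int n..int n} - {0}"
  have len: "length w = n" using length_signed_word[OF w] by simp
  define f where "f p = w ! (n - nat p)" for p :: int
  define \<pi> where "\<pi> x = (if x \<in> {1..int n} then f x else if - x \<in> {1..int n} then - f (- x) else x)" for x
  have wf: "window n \<pi> = w"
  proof (rule nth_equalityI)
    show "length (window n \<pi>) = length w" by (simp add: window_def len del: upt_Suc)
    fix i assume "i < length (window n \<pi>)"
    then have i: "i < n" by (simp add: window_def del: upt_Suc)
    then have "[1..<Suc n] ! (n - Suc i) = n - i" by (simp del: upt_Suc)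
    moreover have "n - nat (int n - int i) = i" "Suc (n - Suc i) = n - i" using i by auto
    ultimately show "window n \<pi> ! i = w ! i" using i
      by (simp add: window_def rev_nth \<pi>_def f_def del: upt_Suc)
  qed
  have f_mem: "\<bar>f x\<bar> \<in> {1..int n}" if "x \<in> {1..int n}" for x
  proof -
    have "f x \<in> set w" unfolding f_def using that len by (intro nth_mem) auto
    then show ?thesis using w by (auto simp: signed_words_def)
  qed
  have f_inj: "x = y" if "x \<in> {1..int n}" "y \<in> {1..int n}" "\<bar>f x\<bar> = \<bar>f y\<bar>" for x y
  proof -
    have "map abs w ! (n - nat x) = map abs w ! (n - nat y)"
      using that len by (simp add: f_def)
    then have "n - nat x = n - nat y"
      using w that len by (subst (asm) nth_eq_iff_index_eq) (auto simp: signed_words_def)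
    then show ?thesis using that by auto
  qed
  have \<pi>_mem: "\<pi> x \<in> ?D" if "x \<in> ?D" for x
  proof -
    have "x \<in> {1..int n} \<or> - x \<in> {1..int n}" using that by auto
    then consider "x \<in> {1..int n}" | "- x \<in> {1..int n}" by blast
    then show ?thesis
      by cases (use f_mem[of x] f_mem[of "- x"] in \<open>auto simp: \<pi>_def\<close>)
  qed
  have inj: "inj_on \<pi> ?D"
  proof (rule inj_onI)
    fix x y assume "x \<in> ?D" "y \<in> ?D" and eq: "\<pi> x = \<pi> y"
    then have xy: "\<bar>x\<bar> \<in> {1..int n}" "\<bar>y\<bar> \<in> {1..int n}" by auto
    have abs: "\<pi> z = (if z > 0 then f \<bar>z\<bar> else - f \<bar>z\<bar>)" if "\<bar>z\<bar> \<in> {1..int n}" for z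
      using that by (auto simp: \<pi>_def)
    have "\<bar>f \<bar>x\<bar>\<bar> = \<bar>f \<bar>y\<bar>\<bar>"
      using eq abs[OF xy(1)] abs[OF xy(2)] by (auto split: if_splits)
    then have "\<bar>x\<bar> = \<bar>y\<bar>" using f_inj xy by blast
    moreover have "f \<bar>x\<bar> \<noteq> 0" using f_mem[OF xy(1)] by auto
    ultimately show "x = y"
      using eq abs[OF xy(1)] abs[OF xy(2)] by (auto split: if_splits)
  qed
  have "\<pi> ` ?D = ?D" using \<pi>_mem by (intro endo_inj_surj inj) auto
  then have "\<pi> permutes ?D"
    using inj by (intro bij_imp_permutes) (auto simp: bij_betw_def \<pi>_def)
  moreover have "\<pi> (- j) = - \<pi> j" if "j \<in> {1..int n}" for j
    using that by (auto simp: \<pi>_def)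
  ultimately have "\<pi> \<in> hyperoctahedral n" by (simp add: hyperoctahedral_def)
  with wf show ?thesis by blast
qed

lemma bij_betw_window: "bij_betw (window n) (hyperoctahedral n) (signed_words {1..int n})"
  using inj_on_window window_hyperoctahedral signed_word_is_window
  by (intro bij_betw_imageI) auto

lemma mahonian_B_eq_coeff:
  "of_nat (mahonian_B n k) = fps_nth (\<Prod>m=1..n. \<Sum>i<2 * m. fps_X ^ i :: 'a :: comm_ring_1 fps) k"
proof -
  let ?S = "signed_words {1..int n}"
  have "bij_betw (window n) {\<pi> \<in> hyperoctahedral n. inv_B n \<pi> = k} {w \<in> ?S. word_inv w = k}"
    using bij_betw_window[of n]
    by (auto simp: bij_betw_def inj_on_def inv_B_eq_word_inv image_iff set_eq_iff) metis+
  then have "mahonian_B n k = card {w \<in> ?S. word_inv w = k}"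
    unfolding mahonian_B_def by (rule bij_betw_same_card)
  then have "(of_nat (mahonian_B n k) :: 'a) = (\<Sum>w | w \<in> ?S \<and> word_inv w = k. 1)"
    by simp
  also have "\<dots> = (\<Sum>w\<in>?S. if word_inv w = k then 1 else 0)"
    by (rule sum.inter_filter) (simp add: finite_signed_words)
  also have "\<dots> = fps_nth (\<Sum>w\<in>?S. fps_X ^ word_inv w) k"
    unfolding fps_sum_nth by (intro sum.cong refl) auto
  also have "(\<Sum>w\<in>?S. fps_X ^ word_inv w :: 'a fps) = (\<Prod>m=1..n. \<Sum>i<2 * m. fps_X ^ i)"
    by (subst sum_word_inv) auto
  finally show ?thesis .
qed

section \<open>A finite form of Euler's pentagonal number theorem\<close>

text \<open>
  Triangular and pentagonal numbers as sums: this form suits induction and avoids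
  truncated subtraction and division.
\<close>

definition tri :: "nat \<Rightarrow> nat" where "tri s = (\<Sum>i\<le>s. i)"

definition pent :: "nat \<Rightarrow> nat" where "pent j = (\<Sum>i<j. 3 * i + 1)"

lemma pentagonal_eq_pent: "pentagonal j = int (pent j)"
proof -
  have "2 * int (pent j) = int j * (3 * int j - 1)"
    by (induction j) (auto simp: pent_def algebra_simps)
  then show ?thesis by (simp add: pentagonal_def)
qed

lemma le_pent: "j \<le> pent j"
  by (induction j) (auto simp: pent_def)

lemma pent_Suc_eq_tri: "pent (Suc n) = n * Suc n + tri (Suc n)"
  by (induction n) (auto simp: pent_def tri_def)

text \<open>
  The left-hand side of Shanks' identity. Its term for \<open>s = 0\<close> is the truncated Euler product, and
  all other terms are multiples of \<open>q ^ Suc n\<close>.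
\<close>

definition shanks_sum :: "'a :: comm_ring_1 \<Rightarrow> nat \<Rightarrow> 'a" where
  "shanks_sum q n = (\<Sum>s\<le>n. (- 1) ^ s * (\<Prod>i\<in>{s<..n}. 1 - q ^ i) * q ^ (n * s + tri s))"

text \<open>
  Passing from \<open>n\<close> to \<open>n + 1\<close> multiplies the term with index \<open>s\<close> by \<open>(1 - q^(n + 1)) q^s\<close>. Writing
  \<open>(1 - q^(n + 1)) q^s - 1 = - (1 - q^s) - q^(n + 1 + s)\<close> turns the change into a telescoping
  difference: the factor \<open>1 - q^s\<close> extends the product downwards by one factor, and
  the other summand is the same expression for \<open>s + 1\<close>. What survives is the upper end of the
  telescope and the new term \<open>s = n + 1\<close>, the two pentagonal powers.
\<close>

lemma shanks_sum_Suc: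
  "shanks_sum q (Suc n) = shanks_sum q n
     + (- 1) ^ Suc n * (q ^ pent (Suc n) + q ^ (pent (Suc n) + Suc n))"
proof -
  let ?Q = "\<lambda>s n. \<Prod>i\<in>{s<..n}. 1 - q ^ i"
  \<comment> \<open>The value at \<open>0\<close> is the vanishing factor \<open>1 - q^0\<close>, which the product from \<open>s - 1\<close> would miss there.\<close>
  define G where "G s = (if s = 0 then 0 else (- 1) ^ s * ?Q (s - 1) n * q ^ (n * s + tri s))" for s
  have step: "(- 1) ^ s * ?Q s (Suc n) * q ^ (Suc n * s + tri s) 
      - (- 1) ^ s * ?Q s n * q ^ (n * s + tri s) = G (Suc s) - G s" if "s \<le> n" for s
  proof -
    have "{s<..Suc n} = insert (Suc n) {s<..n}" using that by auto
    then have top: "?Q s (Suc n) = (1 - q ^ Suc n) * ?Q s n" by simp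
    have bot: "G s = (- 1) ^ s * ((1 - q ^ s) * ?Q s n) * q ^ (n * s + tri s)"
    proof (cases s)
      case (Suc r)
      then have "{r<..n} = insert s {s<..n}" using that by auto
      with Suc show ?thesis by (simp add: G_def)
    qed (simp add: G_def)
    have "G (Suc s) = - ((- 1) ^ s * ?Q s n * (q ^ (n * s + tri s) * q ^ s * q ^ Suc n))"
      by (simp add: G_def tri_def power_add algebra_simps)
    then show ?thesis
      unfolding top bot by (simp add: power_add algebra_simps)
  qed
  have "shanks_sum q (Suc n) - shanks_sum q n = 
       (\<Sum>s\<le>n. (- 1) ^ s * ?Q s (Suc n) * q ^ (Suc n * s + tri s) - (- 1) ^ s * ?Q s n * q ^ (n * s + tri s))
       + (- 1) ^ Suc n * q ^ (Suc n * Suc n + tri (Suc n))"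
    by (simp add: shanks_sum_def sum_subtractf del: power_Suc mult_Suc)
  also have "(\<Sum>s\<le>n. (- 1) ^ s * ?Q s (Suc n) * q ^ (Suc n * s + tri s) - (- 1) ^ s * ?Q s n * q ^ (n * s + tri s))
       = (\<Sum>s<Suc n. G (Suc s) - G s)"
    by (intro sum.cong step) auto
  also have "\<dots> = G (Suc n) - G 0" by (rule sum_lessThan_telescope)
  also have "\<dots> = (- 1) ^ Suc n * q ^ pent (Suc n)"
    by (simp add: G_def pent_Suc_eq_tri del: power_Suc mult_Suc mult_Suc_right)
  also have "Suc n * Suc n + tri (Suc n) = pent (Suc n) + Suc n"
    by (simp add: pent_Suc_eq_tri)
  finally show ?thesis by (simp add: algebra_simps del: power_Suc)
qed

lemma shanks_identity:
  "shanks_sum q n = 1 + (\<Sum>j=1..n. (- 1) ^ j * (q ^ pent j + q ^ (pent j + j)))"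
proof (induction n)
  case 0
  show ?case by (simp add: shanks_sum_def tri_def)
next
  case (Suc n)
  then show ?case by (simp add: shanks_sum_Suc del: power_Suc)
qed

text \<open>
  Euler's theorem modulo \<open>q ^ Suc n\<close>, with the remainder made explicit so that it holds in every
  commutative ring: it collects the terms of Shanks' sum with \<open>s \<ge> 1\<close>.
\<close>

lemma euler_product_mod:
  fixes q :: "'a :: comm_ring_1"
  obtains R where "(\<Prod>m=1..n. 1 - q ^ m)
    = 1 + (\<Sum>j=1..n. (- 1) ^ j * (q ^ pent j + q ^ (pent j + j))) + q ^ Suc n * R"
proof -
  let ?t = "\<lambda>s. (- 1) ^ s * (\<Prod>i\<in>{s<..n}. 1 - q ^ i) * q ^ (n * s + tri s)"
  have "q ^ Suc n dvd ?t s" if "s \<in> {1..n}" for s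
  proof -
    obtain r where "s = Suc r" using \<open>s \<in> {1..n}\<close> by (cases s) auto
    then have "Suc n \<le> n * s + tri s" by (simp add: tri_def)
    then have "q ^ Suc n dvd q ^ (n * s + tri s)" by (rule le_imp_power_dvd)
    then show ?thesis by (rule dvd_mult)
  qed
  then have "q ^ Suc n dvd (\<Sum>s=1..n. ?t s)" by (rule dvd_sum)
  then obtain R where R: "(\<Sum>s=1..n. ?t s) = q ^ Suc n * R" by (elim dvdE)
  have "shanks_sum q n = ?t 0 + (\<Sum>s=1..n. ?t s)"
    unfolding shanks_sum_def by (simp add: sum.atLeast_Suc_atMost atMost_atLeast0)
  also have "?t 0 = (\<Prod>m=1..n. 1 - q ^ m)"
    by (simp add: tri_def atLeastSucAtMost_greaterThanAtMost)
  finally have "shanks_sum q n = (\<Prod>m=1..n. 1 - q ^ m) + q ^ Suc n * R"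
    by (simp only: R)
  then have "(\<Prod>m=1..n. 1 - q ^ m)
    = 1 + (\<Sum>j=1..n. (- 1) ^ j * (q ^ pent j + q ^ (pent j + j))) + q ^ Suc n * (- R)"
    by (simp add: shanks_identity)
  then show ?thesis by (rule that)
qed

section \<open>Extracting the coefficient\<close>

text \<open>Each factor is a geometric sum, equal to \<open>(1 - X^(2 m)) / (1 - X)\<close>.\<close>

lemma mahonian_gf:
  "(\<Prod>m=1..n. \<Sum>i<2 * m. fps_X ^ i :: 'a :: field_char_0 fps)
     = (\<Prod>m=1..n. 1 - (fps_X\<^sup>2) ^ m) * inverse ((1 - fps_X) ^ n)"
proof -
  have "(\<Prod>m=1..n. 1 - (fps_X\<^sup>2) ^ m) = (\<Prod>m=1..n. (1 - fps_X) * (\<Sum>i<2 * m. fps_X ^ i :: 'a fps))"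
    by (intro prod.cong refl) (simp add: one_diff_power_eq[symmetric] power_mult)
  also have "\<dots> = (1 - fps_X) ^ n * (\<Prod>m=1..n. \<Sum>i<2 * m. fps_X ^ i)"
    by (simp add: prod.distrib)
  finally show ?thesis
    using inverse_mult_eq_1[of "(1 - fps_X :: 'a fps) ^ n"]
    by (simp add: mult_ac fps_nth_power_0)
qed

text \<open>
  The convention that binomials with negative lower index vanish is what makes the shift by \<open>X ^ d\<close>
  valid without assuming \<open>d \<le> k\<close>.
\<close>

lemma coeff_inverse_one_minus_X_power:
  assumes "n \<ge> 1"
  shows "fps_nth (fps_X ^ d * inverse ((1 - fps_X) ^ n)) k
           = int_binomial (int n + int k - int d - 1) (int k - int d)"
proof -
  have "inverse ((1 - fps_X :: real fps) ^ n) = Abs_fps (\<lambda>k. of_nat ((n + k - 1) choose k))"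
    using one_minus_const_fps_X_neg_power'[of n "1 :: real"] assms by simp
  moreover have "real_of_int (int n + int k - int d - 1) = real (n + (k - d) - 1)" 
    "nat (int k - int d) = k - d" if "d \<le> k"
    using assms that by auto
  ultimately show ?thesis
    by (simp add: fps_X_power_mult_nth int_binomial_def binomial_gbinomial)
qed

theorem theorem3p4:
  fixes n k :: nat
  assumes "n \<ge> 1" and "k \<le> n"
  shows "real (mahonian_B n k) =
           int_binomial (int n + int k - 1) (int k)
         + (\<Sum>\<^sub>\<infinity>j\<in>{1::nat..}. (- 1) ^ j *
              int_binomial (int n + int k - 2 * pentagonal j - 2 * int j - 1)
                                        (int k - 2 * pentagonal j - 2 * int j))
         + (\<Sum>\<^sub>\<infinity>j\<in>{1::nat..}. (- 1) ^ j *
              int_binomial (int n + int k - 2 * pentagonal j - 1)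
                                        (int k - 2 * pentagonal j))"
proof -
  let ?B = "\<lambda>d. int_binomial (int n + int k - int d - 1) (int k - int d)"
  let ?H = "inverse ((1 - fps_X) ^ n) :: real fps"
  have B: "fps_nth (fps_X ^ d * ?H) k = ?B d" for d
    by (rule coeff_inverse_one_minus_X_power) fact
  have signed: "fps_nth ((- 1) ^ j * f) k = (- 1) ^ j * fps_nth f k" for j and f :: "real fps"
    by (cases "even j") auto
  \<comment> \<open>The summands with \<open>j > n\<close> vanish, as their lower index is at most \<open>k - 2 j < 0\<close>.\<close>
  have tail: "(\<Sum>\<^sub>\<infinity>j\<in>{1::nat..}. (- 1) ^ j * ?B (2 * e j)) = (\<Sum>j=1..n. (- 1) ^ j * ?B (2 * e j))"
    if "\<And>j. j \<le> e j" for e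
  proof -
    have "?B (2 * e j) = 0" if "j > n" for j
      using \<open>\<And>j. j \<le> e j\<close>[of j] that assms(2) by (simp add: int_binomial_def)
    then have "(\<Sum>\<^sub>\<infinity>j\<in>{1::nat..}. (- 1) ^ j * ?B (2 * e j)) = (\<Sum>\<^sub>\<infinity>j\<in>{1..n}. (- 1) ^ j * ?B (2 * e j))"
      by (intro infsum_cong_neutral) auto
    then show ?thesis by simp
  qed
  obtain R where R: "(\<Prod>m=1..n. 1 - (fps_X\<^sup>2 :: real fps) ^ m)
      = 1 + (\<Sum>j=1..n. (- 1) ^ j * ((fps_X\<^sup>2) ^ pent j + (fps_X\<^sup>2) ^ (pent j + j))) + (fps_X\<^sup>2) ^ Suc n * R"
    by (rule euler_product_mod)
  have "real (mahonian_B n k) = fps_nth ((\<Prod>m=1..n. 1 - (fps_X\<^sup>2) ^ m) * ?H) k"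
    unfolding mahonian_gf[symmetric] by (rule mahonian_B_eq_coeff)
  also have "(\<Prod>m=1..n. 1 - (fps_X\<^sup>2) ^ m) * ?H
      = fps_X ^ 0 * ?H
      + (\<Sum>j=1..n. (- 1) ^ j * (fps_X ^ (2 * (pent j + j)) * ?H))
      + (\<Sum>j=1..n. (- 1) ^ j * (fps_X ^ (2 * pent j) * ?H))
      + fps_X ^ (2 * Suc n) * (R * ?H)"
    unfolding R
    by (simp add: power_mult[symmetric] ring_distribs sum_distrib_right sum.distrib mult.assoc
          del: power_Suc mult_Suc_right)
  \<comment> \<open>The remainder starts at degree \<open>2 (n + 1) > k\<close> and drops out.\<close>
  also have "fps_nth \<dots> k = ?B 0 + (\<Sum>j=1..n. (- 1) ^ j * ?B (2 * (pent j + j)))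
      + (\<Sum>j=1..n. (- 1) ^ j * ?B (2 * pent j))"
    using assms(2) by (simp only: fps_add_nth fps_sum_nth signed B) (simp add: fps_X_power_mult_nth del: power_Suc)
  also have "\<dots> = ?B 0 + (\<Sum>\<^sub>\<infinity>j\<in>{1::nat..}. (- 1) ^ j * ?B (2 * (pent j + j)))
      + (\<Sum>\<^sub>\<infinity>j\<in>{1::nat..}. (- 1) ^ j * ?B (2 * pent j))"
    using tail[of "\<lambda>j. pent j + j"] tail[of pent, OF le_pent] by simp
  finally show ?thesis
    by (simp add: pentagonal_eq_pent algebra_simps)
qed

end
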